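(* The universal interpolation property and the universal approximation property are not equivalent for control systems in general. Concretely, (1) there exists a control system that possesses the exact universal interpolation property, but does not possess the universal approximation property (in $L^p$ sense); (2) there exists a control system that possesses the universal approximation property (in $L^p$ sense), but does not possess the exact universal interpolation property.
   Context: Consider control systems $\dot x(t)=f(x(t);\theta(t))$, $x(0)=x_0$, on $\mathbb R^d$ with $d\ge 2$, where the control $\theta(t)$ takes values in a fixed set $\Theta\subseteq\mathbb R^l$ and is piecewise constant in time, and $x\mapsto f(x;\theta)$ is (at least locally) Lipschitz for each $\theta$. The control family is $\mathcal F=\{x\mapsto f(x;\theta)\mid\theta\in\Theta\}$. For $g\in\mathcal F$, $\varphi^g_t$ denotes the flow map $x_0\mapsto x(t)$ of $\dot x=g(x)$. The attainable set $\mathcal A_{\mathcal F}$ is the set of all finite compositions $\varphi^{f_k}_{t_k}\circ\cdots\circ\varphi^{f_1}_{t_1}$ with $f_i\in\mathcal F$, $t_i\ge 0$, $k\ge1$ (for locally Lipschitz families, restricted to times for which the flows exist on the relevant compact set). The system has the exact universal interpolation property if for any positive integer $N$ and any data $(x_1,y_1),\dots,(x_N,y_N)$ in $\mathbb R^d\times\mathbb R^d$ with $x_i\ne x_j$ and $y_i\ne y_j$ for $i\ne j$, there exists $\varphi\in\mathcal A_{\mathcal F}$ with $\varphi(x_i)=y_i$ for all $i$. The system has the universal approximation property in $L^p$ sense ($1\le p<\infty$) if for any continuous $F:\mathbb R^d\to\mathbb R^d$, compact $K\subseteq\mathbb R^d$ and $\varepsilon>0$ there exists $\varphi\in\mathcal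 A_{\mathcal F}$ with $\|F-\varphi\|_{L^p(K)}<\varepsilon$. *)

theory Defs
  imports "HOL-Analysis.Analysis"
begin

definition is_solution :: "('a::real_normed_vector \<Rightarrow> 'a) \<Rightarrow> 'a \<Rightarrow> real \<Rightarrow> (real \<Rightarrow> 'a) \<Rightarrow> bool" where
  "is_solution g x t u \<longleftrightarrow> u 0 = x \<and>
     (\<forall>s\<in>{0..t}. (u has_vector_derivative g (u s)) (at s within {0..t}))"

definition flow_exists :: "('a::real_normed_vector \<Rightarrow> 'a) \<Rightarrow> real \<Rightarrow> 'a \<Rightarrow> bool" where
  "flow_exists g t x \<longleftrightarrow> 0 \<le> t \<and> (\<exists>u. is_solution g x t u)"

text \<open>Flow map; well defined (by uniqueness of solutions) for locally Lipschitz g where it exists.\<close>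
definition flow :: "('a::real_normed_vector \<Rightarrow> 'a) \<Rightarrow> real \<Rightarrow> 'a \<Rightarrow> 'a" where
  "flow g t x = (THE y. \<exists>u. is_solution g x t u \<and> u t = y)"

fun comp_flows :: "(('a::real_normed_vector \<Rightarrow> 'a) \<times> real) list \<Rightarrow> 'a \<Rightarrow> 'a" where
  "comp_flows [] = id"
| "comp_flows ((g, t) # ps) = comp_flows ps \<circ> flow g t"

fun comp_defined :: "(('a::real_normed_vector \<Rightarrow> 'a) \<times> real) list \<Rightarrow> 'a \<Rightarrow> bool" where
  "comp_defined [] x = True"
| "comp_defined ((g, t) # ps) x = (flow_exists g t x \<and> comp_defined ps (flow g t x))"

definition attainable_on :: "('a::real_normed_vector \<Rightarrow> 'a) set \<Rightarrow> 'a set \<Rightarrow> ('a \<Rightarrow> 'a) \<Rightarrow> bool" where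
  "attainable_on F S \<phi> \<longleftrightarrow> (\<exists>ps. ps \<noteq> [] \<and> (\<forall>p\<in>set ps. fst p \<in> F \<and> 0 \<le> snd p)
      \<and> (\<forall>x\<in>S. comp_defined ps x) \<and> \<phi> = comp_flows ps)"

definition control_family :: "'c set \<Rightarrow> ('a \<Rightarrow> 'c \<Rightarrow> 'a) \<Rightarrow> ('a \<Rightarrow> 'a) set" where
  "control_family \<Theta> f = {(\<lambda>x. f x \<theta>) | \<theta>. \<theta> \<in> \<Theta>}"

definition universal_interpolation :: "('a::real_normed_vector \<Rightarrow> 'a) set \<Rightarrow> bool" where
  "universal_interpolation F \<longleftrightarrow>
     (\<forall>N::nat. \<forall>xs ys :: nat \<Rightarrow> 'a. 0 < N \<and> inj_on xs {..<N} \<and> inj_on ys {..<N} \<longrightarrow>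
        (\<exists>\<phi>. attainable_on F (xs ` {..<N}) \<phi> \<and> (\<forall>i<N. \<phi> (xs i) = ys i)))"

definition Lp_close :: "real \<Rightarrow> 'a::euclidean_space set \<Rightarrow> ('a \<Rightarrow> 'a) \<Rightarrow> ('a \<Rightarrow> 'a) \<Rightarrow> real \<Rightarrow> bool" where
  "Lp_close p K F \<phi> \<epsilon> \<longleftrightarrow>
     (\<integral>\<^sup>+ x. indicator K x * ennreal (norm (F x - \<phi> x) powr p) \<partial>lborel) < ennreal (\<epsilon> powr p)"

definition universal_approximation_Lp :: "real \<Rightarrow> ('a::euclidean_space \<Rightarrow> 'a) set \<Rightarrow> bool" where
  "universal_approximation_Lp p F \<longleftrightarrow>
     (\<forall>G K \<epsilon>. continuous_on UNIV G \<and> compact K \<and> 0 < \<epsilon> \<longrightarrow>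
        (\<exists>\<phi>. attainable_on F K \<phi> \<and> Lp_close p K G \<phi> \<epsilon>))"

definition control_system :: "nat \<Rightarrow> real list set \<Rightarrow> ('a::real_normed_vector \<Rightarrow> real list \<Rightarrow> 'a) \<Rightarrow> bool" where
  "control_system l \<Theta> f \<longleftrightarrow> (\<forall>\<theta>\<in>\<Theta>. length \<theta> = l) \<and>
     (\<forall>\<theta>\<in>\<Theta>. local_lipschitz (UNIV::real set) UNIV (\<lambda>_ x. f x \<theta>))"

end

theory Submission
  imports Defs
begin

text \<open>Both systems are built from the shears \<open>x \<mapsto> x + a x\<^sub>j\<^sup>k e\<^sub>i\<close> with \<open>i \<noteq> j\<close>, the time-one maps of monomial
  vector fields. Composing them realises polynomial shears, and these interpolate any finite set of
  distinct nonzero points even if \<open>k \<ge> 1\<close>, when all shears fix the origin.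

  (1) If \<open>k = 0\<close> is admitted, translations move the data away from the origin, so exact interpolation
  holds. All attainable maps preserve Lebesgue measure, hence none of them is \<open>L\<^sup>p\<close>-close to \<open>0\<close> on a
  large ball.

  (2) If only \<open>k \<ge> 1\<close> is admitted, add the fields \<open>w sin (x\<^sub>i / w)\<close>. Everything still vanishes at the
  origin, so interpolation fails. The new flows contract almost every point to the centre of its cell
  in a grid of width \<open>2 \<pi> w\<close>; these centres are nonzero, so a shear map can send them to perturbed
  values of the target function.\<close>

section \<open>Flows and attainable maps\<close>

text \<open>A Gronwall argument: with \<open>L\<close> a Lipschitz constant of \<open>g\<close> on
  the compact set swept by both trajectories, \<open>exp (-(2 * L * s))\<close> times the squared
  distance is nonincreasing and starts at 0.\<close>

lemma is_solution_unique:
  fixes g :: "'a::euclidean_space \<Rightarrow> 'a"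
  assumes ll: "local_lipschitz (UNIV::real set) UNIV (\<lambda>_. g)"
    and u: "is_solution g x t u" and v: "is_solution g x t v" and t: "0 \<le> t"
  shows "u t = v t"
proof -
  have cu: "continuous_on {0..t} u" and cv: "continuous_on {0..t} v"
    using u v unfolding is_solution_def continuous_on_eq_continuous_within
    by (auto intro: has_vector_derivative_continuous)
  define X where "X = u ` {0..t} \<union> v ` {0..t}"
  have "compact X"
    unfolding X_def using cu cv by (intro compact_Un compact_continuous_image) auto
  have "local_lipschitz {0::real} X (\<lambda>_. g)"
    using local_lipschitz_subset[OF ll] by simp
  then obtain L where L: "L-lipschitz_on X g"
    using local_lipschitz_compact_implies_lipschitz[of "{0::real}" X "\<lambda>_. g"] \<open>compact X\<close>
    by (auto intro: continuous_on_const)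
  define w where "w s = exp (-(2 * L * s)) * ((u s - v s) \<bullet> (u s - v s))" for s
  have cw: "continuous_on {0..t} w"
    unfolding w_def using cu cv by (intro continuous_intros) auto
  have "w 0 \<ge> w t"
  proof (rule DERIV_nonpos_imp_decreasing_open[OF t _ cw])
    fix s assume s: "0 < s" "s < t"
    have at: "at s within {0..t} = at s"
      using s by (rule at_within_Icc_at)
    have "(u has_vector_derivative g (u s)) (at s)" "(v has_vector_derivative g (v s)) (at s)"
      using u v s unfolding is_solution_def at[symmetric] by auto
    then have d: "((\<lambda>s. u s - v s) has_vector_derivative (g (u s) - g (v s))) (at s)"
      by (intro derivative_intros)
    have "((\<lambda>s. (u s - v s) \<bullet> (u s - v s)) has_vector_derivative
        ((u s - v s) \<bullet> (g (u s) - g (v s)) + (g (u s) - g (v s)) \<bullet> (u s - v s))) (at s)"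
      by (rule bounded_bilinear.has_vector_derivative[OF bounded_bilinear_inner d d])
    then have d2: "((\<lambda>s. (u s - v s) \<bullet> (u s - v s)) has_real_derivative
        (2 * ((u s - v s) \<bullet> (g (u s) - g (v s))))) (at s)"
      by (simp add: has_real_derivative_iff_has_vector_derivative
          inner_commute[of "g (u s) - g (v s)"])
    have D: "(w has_real_derivative
        (exp (-(2 * L * s)) * (2 * ((u s - v s) \<bullet> (g (u s) - g (v s))))
         - 2 * L * exp (-(2 * L * s)) * ((u s - v s) \<bullet> (u s - v s)))) (at s)"
      unfolding w_def by (auto intro!: derivative_eq_intros d2)
    have "(u s - v s) \<bullet> (g (u s) - g (v s)) \<le> L * ((u s - v s) \<bullet> (u s - v s))"
    proof -
      have "u s \<in> X" "v s \<in> X"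
        using s by (auto simp: X_def)
      then have "norm (g (u s) - g (v s)) \<le> L * norm (u s - v s)"
        using lipschitz_on_normD[OF L] by blast
      then have "norm (u s - v s) * norm (g (u s) - g (v s)) \<le> norm (u s - v s) * (L * norm (u s - v s))"
        by (rule mult_left_mono) simp
      then show ?thesis
        using norm_cauchy_schwarz[of "u s - v s" "g (u s) - g (v s)"]
        by (simp add: dot_square_norm power2_eq_square mult_ac)
    qed
    then have "exp (-(2 * L * s)) * (2 * ((u s - v s) \<bullet> (g (u s) - g (v s))))
        \<le> exp (-(2 * L * s)) * (2 * (L * ((u s - v s) \<bullet> (u s - v s))))"
      by simp
    then show "\<exists>y. (w has_real_derivative y) (at s) \<and> y \<le> 0"
      using D by (intro exI[of _ "exp (- (2 * L * s)) * (2 * ((u s - v s) \<bullet> (g (u s) - g (v s)))) -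
          2 * L * exp (- (2 * L * s)) * ((u s - v s) \<bullet> (u s - v s))"]) (simp add: mult_ac)
  qed
  moreover have "w 0 = 0"
    using u v by (simp add: w_def is_solution_def)
  ultimately have "(u t - v t) \<bullet> (u t - v t) \<le> 0"
    unfolding w_def by (simp add: mult_le_0_iff)
  then show ?thesis
    by (metis eq_iff_diff_eq_0 inner_eq_zero_iff inner_ge_zero nle_le)
qed

lemma flow_eqI:
  fixes g :: "'a::euclidean_space \<Rightarrow> 'a"
  assumes "local_lipschitz (UNIV::real set) UNIV (\<lambda>_. g)" "is_solution g x t u" "0 \<le> t"
  shows "flow g t x = u t"
  unfolding flow_def
  by (rule the_equality) (use assms is_solution_unique[OF assms(1)] in blast)+

lemma local_lipschitz_autonomousI:
  fixes g :: "'a::metric_space \<Rightarrow> 'b::metric_space"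
  assumes "\<And>x. \<exists>L. L-lipschitz_on (cball x 1) g"
  shows "local_lipschitz (UNIV::real set) UNIV (\<lambda>_. g)"
proof (rule local_lipschitzI)
  fix x :: 'a and t :: real
  obtain L where "L-lipschitz_on (cball x 1) g"
    using assms by blast
  then show "\<exists>u>0. \<exists>L. \<forall>t\<in>cball t u \<inter> UNIV. L-lipschitz_on (cball x u \<inter> UNIV) g"
    by (intro exI[of _ 1]) auto
qed

lemma attainable_on_mono:
  "attainable_on F UNIV \<phi> \<Longrightarrow> F \<subseteq> F' \<Longrightarrow> attainable_on F' S \<phi>"
  unfolding attainable_on_def by blast

lemma comp_flows_append: "comp_flows (ps @ qs) = comp_flows qs \<circ> comp_flows ps"
proof (induction ps)
  case (Cons p ps)
  then show ?case
    by (cases p) (simp add: o_assoc)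
qed simp

lemma comp_defined_append:
  "comp_defined (ps @ qs) x \<longleftrightarrow> comp_defined ps x \<and> comp_defined qs (comp_flows ps x)"
  by (induction ps x rule: comp_defined.induct) auto

lemma attainable_on_UNIV_comp:
  assumes "attainable_on F UNIV \<phi>" "attainable_on F UNIV \<psi>"
  shows "attainable_on F UNIV (\<psi> \<circ> \<phi>)"
proof -
  obtain ps qs where "ps \<noteq> []" "\<forall>p\<in>set ps \<union> set qs. fst p \<in> F \<and> 0 \<le> snd p"
    "\<forall>x. comp_defined ps x" "\<forall>x. comp_defined qs x" "\<phi> = comp_flows ps" "\<psi> = comp_flows qs"
    using assms unfolding attainable_on_def by auto
  then show ?thesis
    unfolding attainable_on_def
    by (intro exI[of _ "ps @ qs"]) (simp add: comp_flows_append comp_defined_append ball_Un)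
qed

lemma attainable_on_flow:
  assumes "g \<in> F" "0 \<le> t" "\<And>x. x \<in> S \<Longrightarrow> flow_exists g t x"
  shows "attainable_on F S (flow g t)"
  unfolding attainable_on_def
  by (intro exI[of _ "[(g, t)]"]) (use assms in auto)

text \<open>A common zero of all fields is a constant solution, hence fixed by every composition of
  flows; this is the obstruction to interpolation in (2).\<close>

lemma comp_flows_fixed_point:
  fixes F :: "('a::euclidean_space \<Rightarrow> 'a) set"
  assumes "\<And>g. g \<in> F \<Longrightarrow> local_lipschitz (UNIV::real set) UNIV (\<lambda>_. g)"
    and "\<And>g. g \<in> F \<Longrightarrow> g z = 0"
    and "\<forall>p\<in>set ps. fst p \<in> F \<and> 0 \<le> snd p"
  shows "comp_flows ps z = z"
  using assms(3)
proof (induction ps rule: comp_flows.induct)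
  case (2 g t ps)
  then have g: "g \<in> F" "0 \<le> t" and IH: "comp_flows ps z = z"
    by auto
  have "is_solution g z t (\<lambda>_. z)"
    using assms(2)[OF g(1)] by (simp add: is_solution_def)
  from flow_eqI[OF assms(1)[OF g(1)] this g(2)] IH show ?case
    by simp
qed simp

text \<open>A countable index and a real parameter are packed into two real controls.\<close>

lemma control_system_countable_real:
  fixes g :: "'c::countable \<Rightarrow> real \<Rightarrow> 'a::real_normed_vector \<Rightarrow> 'a"
  assumes "\<And>c a. c \<in> C \<Longrightarrow> local_lipschitz (UNIV::real set) UNIV (\<lambda>_. g c a)"
  obtains l \<Theta> f where "control_system l \<Theta> f"
    and "control_family \<Theta> f = {g c a | c a. c \<in> C}"
proof
  let ?\<Theta> = "{[real (to_nat c), a] | c a. c \<in> C}"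
  let ?f = "\<lambda>x \<theta>. g (from_nat (nat \<lfloor>\<theta> ! 0\<rfloor>)) (\<theta> ! 1) x"
  show "control_system 2 ?\<Theta> ?f"
    unfolding control_system_def using assms by auto
  show "control_family ?\<Theta> ?f = {g c a | c a. c \<in> C}"
    unfolding control_family_def by force
qed

section \<open>Shears\<close>

definition shear_field :: "'n \<Rightarrow> 'n \<Rightarrow> (real \<Rightarrow> real) \<Rightarrow> real^'n \<Rightarrow> real^'n::finite" where
  "shear_field i j h x = h (x $ j) *\<^sub>R axis i 1"

definition shear :: "'n \<Rightarrow> 'n \<Rightarrow> (real \<Rightarrow> real) \<Rightarrow> real^'n \<Rightarrow> real^'n::finite" where
  "shear i j h x = x + shear_field i j h x"

text \<open>The exponent set \<open>K\<close> tells the two systems apart: \<open>UNIV\<close>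
  includes constant fields, hence translations, whereas every field for \<open>{1..}\<close>
  vanishes at the origin.\<close>

definition monomial_shears :: "nat set \<Rightarrow> (real^'n \<Rightarrow> real^'n::finite) set" where
  "monomial_shears K = {shear_field i j (\<lambda>s. a * s ^ k) | i j a k. i \<noteq> j \<and> k \<in> K}"

text \<open>The maps attainable by monomial shears, described without flows so that statements about
  them follow by induction. Running time is absorbed into the coefficient \<open>a\<close>, whose
  sign is free.\<close>

inductive shear_map :: "nat set \<Rightarrow> (real^'n \<Rightarrow> real^'n::finite) \<Rightarrow> bool" for K where
  shear: "i \<noteq> j \<Longrightarrow> k \<in> K \<Longrightarrow> shear_map K (shear i j (\<lambda>s. a * s ^ k))"
| comp: "shear_map K \<phi> \<Longrightarrow> shear_map K \<psi> \<Longrightarrow> shear_map K (\<phi> \<circ> \<psi>)"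

lemma shear_nth: "shear i j h x $ l = (if l = i then x $ l + h (x $ j) else x $ l)"
  by (simp add: shear_def shear_field_def axis_def)

lemma power_lipschitz_bounded:
  fixes M :: real
  assumes "0 \<le> M"
  shows "\<exists>L\<ge>0. \<forall>s r. \<bar>s\<bar> \<le> M \<longrightarrow> \<bar>r\<bar> \<le> M \<longrightarrow> \<bar>s ^ k - r ^ k\<bar> \<le> L * \<bar>s - r\<bar>"
proof (induction k)
  case (Suc k)
  then obtain L where L: "L \<ge> 0" "\<And>s r. \<bar>s\<bar> \<le> M \<Longrightarrow> \<bar>r\<bar> \<le> M \<Longrightarrow> \<bar>s ^ k - r ^ k\<bar> \<le> L * \<bar>s - r\<bar>"
    by blast
  have "\<bar>s ^ Suc k - r ^ Suc k\<bar> \<le> (M * L + M ^ k) * \<bar>s - r\<bar>" if "\<bar>s\<bar> \<le> M" "\<bar>r\<bar> \<le> M" for s r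
  proof -
    have "s ^ Suc k - r ^ Suc k = s * (s ^ k - r ^ k) + (s - r) * r ^ k"
      by (simp add: algebra_simps)
    then have "\<bar>s ^ Suc k - r ^ Suc k\<bar> \<le> \<bar>s\<bar> * \<bar>s ^ k - r ^ k\<bar> + \<bar>s - r\<bar> * \<bar>r\<bar> ^ k"
      by (metis abs_mult abs_triangle_ineq power_abs)
    also have "\<dots> \<le> M * (L * \<bar>s - r\<bar>) + \<bar>s - r\<bar> * M ^ k"
      using that L(2)[OF that] assms by (intro add_mono mult_mono power_mono) auto
    finally show ?thesis
      by (simp add: algebra_simps)
  qed
  then show ?case
    using L(1) assms by (intro exI[of _ "M * L + M ^ k"]) auto
qed auto

lemma local_lipschitz_monomial_shear:
  fixes i j :: "'n::finite"
  shows "local_lipschitz (UNIV::real set) UNIV (\<lambda>_. shear_field i j (\<lambda>s. a * s ^ k))"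
proof (rule local_lipschitz_autonomousI)
  fix x :: "real^'n"
  have bound: "\<bar>y $ j\<bar> \<le> norm x + 1" if "y \<in> cball x 1" for y
  proof -
    have "norm (y - x) \<le> 1"
      using that by (simp add: dist_norm norm_minus_commute)
    then show ?thesis
      using component_le_norm_cart[of y j] norm_triangle_sub[of y x] by linarith
  qed
  obtain L where L: "L \<ge> 0" and *: "\<forall>s r. \<bar>s\<bar> \<le> norm x + 1 \<longrightarrow> \<bar>r\<bar> \<le> norm x + 1 \<longrightarrow>
      \<bar>s ^ k - r ^ k\<bar> \<le> L * \<bar>s - r\<bar>"
    using power_lipschitz_bounded[of "norm x + 1" k] by auto
  have "(\<bar>a\<bar> * L)-lipschitz_on (cball x 1) (shear_field i j (\<lambda>s. a * s ^ k))"
  proof (rule lipschitz_onI)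
    fix y z assume "y \<in> cball x 1" "z \<in> cball x 1"
    then have "\<bar>(y $ j) ^ k - (z $ j) ^ k\<bar> \<le> L * \<bar>y $ j - z $ j\<bar>"
      using bound * by blast
    also have "\<dots> \<le> L * norm (y - z)"
      using component_le_norm_cart[of "y - z" j] L by (intro mult_left_mono) auto
    finally have "\<bar>a\<bar> * \<bar>(y $ j) ^ k - (z $ j) ^ k\<bar> \<le> \<bar>a\<bar> * (L * norm (y - z))"
      by (intro mult_left_mono) auto
    then show "dist (shear_field i j (\<lambda>s. a * s ^ k) y) (shear_field i j (\<lambda>s. a * s ^ k) z)
        \<le> \<bar>a\<bar> * L * dist y z"
      by (simp add: dist_norm shear_field_def norm_axis_1 mult.assoc flip: scaleR_diff_left right_diff_distrib abs_mult)
  qed (use L in auto)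
  then show "\<exists>L. L-lipschitz_on (cball x 1) (shear_field i j (\<lambda>s. a * s ^ k))"
    by blast
qed

text \<open>Since \<open>i \<noteq> j\<close>, coordinate \<open>j\<close> is constant in time, so
  the field is constant along the trajectory, which is a straight line.\<close>

lemma is_solution_shear_field:
  assumes "i \<noteq> j"
  shows "is_solution (shear_field i j h) x t (\<lambda>s. x + (s * h (x $ j)) *\<^sub>R axis i 1)"
  using assms unfolding is_solution_def shear_field_def
  by (auto intro!: derivative_eq_intros simp: axis_def has_vector_derivative_def)

lemma flow_monomial_shear:
  fixes i j :: "'n::finite"
  assumes "i \<noteq> j" "0 \<le> t"
  shows "flow (shear_field i j (\<lambda>s. a * s ^ k)) t = shear i j (\<lambda>s. (t * a) * s ^ k)"
proof
  fix x :: "real^'n"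
  show "flow (shear_field i j (\<lambda>s. a * s ^ k)) t x = shear i j (\<lambda>s. (t * a) * s ^ k) x"
    using flow_eqI[OF local_lipschitz_monomial_shear is_solution_shear_field[OF assms(1)] assms(2)]
    by (simp add: shear_def shear_field_def mult.assoc)
qed

lemma shear_map_attainable:
  "shear_map K \<phi> \<Longrightarrow> attainable_on (monomial_shears K) UNIV \<phi>"
proof (induction rule: shear_map.induct)
  case (shear i j k a)
  have "attainable_on (monomial_shears K) UNIV (flow (shear_field i j (\<lambda>s. a * s ^ k)) 1)"
    using shear is_solution_shear_field[OF shear(1)]
    by (intro attainable_on_flow) (auto simp: monomial_shears_def flow_exists_def)
  then show ?case
    using shear by (simp add: flow_monomial_shear)
qed (rule attainable_on_UNIV_comp)

text \<open>Converse of \<open>shear_map_attainable\<close>. The negative claim in (1) has to cover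
  all attainable maps.\<close>

lemma shear_map_comp_flows:
  assumes "ps \<noteq> []" "\<forall>p\<in>set ps. fst p \<in> monomial_shears K \<and> 0 \<le> snd p"
  shows "shear_map K (comp_flows ps)"
  using assms
proof (induction ps)
  case (Cons p ps)
  obtain g t where p: "p = (g, t)"
    by fastforce
  have "shear_map K (flow g t)"
    using Cons.prems by (auto simp: p monomial_shears_def flow_monomial_shear intro: shear_map.shear)
  then show ?case
    using Cons by (cases "ps = []") (auto simp: p comp_def intro: shear_map.comp[unfolded comp_def])
qed simp

lemma shear_map_mono: "shear_map K \<phi> \<Longrightarrow> K \<subseteq> K' \<Longrightarrow> shear_map K' \<phi>"
  by (induction rule: shear_map.induct) (auto intro: shear_map.intros)

lemma continuous_on_shear_map: "shear_map K \<phi> \<Longrightarrow> continuous_on UNIV \<phi>"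
proof (induction rule: shear_map.induct)
  case (shear i j k a)
  then show ?case
    unfolding shear_def shear_field_def by (intro continuous_intros)
next
  case (comp \<phi> \<psi>)
  then show ?case
    by (metis continuous_on_compose continuous_on_subset subset_UNIV)
qed

section \<open>Invariance of Lebesgue measure under shears\<close>

text \<open>Tonelli on the product of one-dimensional Lebesgue measures, with coordinate
  \<open>b\<close> innermost, the one that a shear in direction \<open>b\<close> changes.\<close>

lemma nn_integral_lborel_split:
  fixes F :: "'a::euclidean_space \<Rightarrow> ennreal"
  assumes b: "b \<in> Basis" and F [measurable]: "F \<in> borel_measurable borel"
  shows "(\<integral>\<^sup>+x. F x \<partial>lborel) =
    (\<integral>\<^sup>+v. \<integral>\<^sup>+y. F ((\<Sum>c\<in>Basis - {b}. v c *\<^sub>R c) + y *\<^sub>R b) \<partial>lborel \<partial>(\<Pi>\<^sub>M c\<in>Basis - {b}. lborel))"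
proof -
  interpret product_sigma_finite "\<lambda>_::'a. lborel :: real measure"
    by standard
  let ?s = "\<lambda>f. \<Sum>c\<in>Basis. f c *\<^sub>R c :: 'a"
  have m [measurable]: "?s \<in> borel_measurable (\<Pi>\<^sub>M c\<in>Basis. lborel)"
    by measurable
  have eq: "?s (v(b := y)) = (\<Sum>c\<in>Basis - {b}. v c *\<^sub>R c) + y *\<^sub>R b" for v y
  proof -
    have "?s (v(b := y)) = y *\<^sub>R b + (\<Sum>c\<in>Basis - {b}. (v(b := y)) c *\<^sub>R c)"
      using b by (subst sum.remove[of _ b]) auto
    also have "(\<Sum>c\<in>Basis - {b}. (v(b := y)) c *\<^sub>R c) = (\<Sum>c\<in>Basis - {b}. v c *\<^sub>R c)"
      by (intro sum.cong) auto
    finally show ?thesis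
      by simp
  qed
  have ins: "insert b (Basis - {b}) = Basis"
    using b by auto
  have "(\<integral>\<^sup>+x. F x \<partial>lborel) = (\<integral>\<^sup>+v. F (?s v) \<partial>(\<Pi>\<^sub>M c\<in>Basis. lborel))"
    by (subst lborel_eq) (simp add: nn_integral_distr)
  also have "\<dots> = (\<integral>\<^sup>+v. F (?s v) \<partial>(\<Pi>\<^sub>M c\<in>insert b (Basis - {b}). lborel))"
    by (simp only: ins)
  also have "\<dots> = (\<integral>\<^sup>+v. \<integral>\<^sup>+y. F (?s (v(b := y))) \<partial>lborel \<partial>(\<Pi>\<^sub>M c\<in>Basis - {b}. lborel))"
    by (rule product_nn_integral_insert) (auto simp: ins)
  finally show ?thesis
    by (simp only: eq)
qed

text \<open>With the other coordinates frozen, the shear translates coordinate \<open>b\<close> by a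
  constant, and one-dimensional Lebesgue measure is translation invariant.\<close>

lemma distr_lborel_shear_Basis:
  fixes b c :: "'a::euclidean_space"
  assumes b: "b \<in> Basis" "c \<in> Basis" "b \<noteq> c" and h [measurable]: "h \<in> borel_measurable borel"
  shows "distr lborel borel (\<lambda>x. x + h (x \<bullet> c) *\<^sub>R b) = lborel"
proof (rule measure_eqI)
  fix A assume "A \<in> sets (distr lborel borel (\<lambda>x. x + h (x \<bullet> c) *\<^sub>R b))"
  then have A [measurable]: "A \<in> sets borel"
    by simp
  have "emeasure (distr lborel borel (\<lambda>x. x + h (x \<bullet> c) *\<^sub>R b)) A
      = (\<integral>\<^sup>+x. indicator A x \<partial>distr lborel borel (\<lambda>x. x + h (x \<bullet> c) *\<^sub>R b))"
    by simp
  also have "\<dots> = (\<integral>\<^sup>+x. indicator A (x + h (x \<bullet> c) *\<^sub>R b) \<partial>lborel)"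
    by (intro nn_integral_distr) auto
  \<comment> \<open>Coordinate \<open>c\<close> of the point is \<open>v c\<close>, as
    \<open>b \<noteq> c\<close>. Writing \<open>1 * y\<close> gives the form of an affine
    substitution with slope 1.\<close>
  also have "\<dots> = (\<integral>\<^sup>+v. \<integral>\<^sup>+y. indicator A ((\<Sum>d\<in>Basis - {b}. v d *\<^sub>R d) + (h (v c) + 1 * y) *\<^sub>R b)
      \<partial>lborel \<partial>(\<Pi>\<^sub>M c\<in>Basis - {b}. lborel))"
  proof -
    have eq: "((\<Sum>d\<in>Basis - {b}. v d *\<^sub>R d) + y *\<^sub>R b) \<bullet> c = v c" for v :: "'a \<Rightarrow> real" and y
      using b by (simp add: inner_add_left inner_sum_left inner_Basis if_distrib sum.delta cong: if_cong)
    have "(\<integral>\<^sup>+x. indicator A (x + h (x \<bullet> c) *\<^sub>R b) \<partial>lborel) =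
      (\<integral>\<^sup>+v. \<integral>\<^sup>+y. indicator A ((\<Sum>d\<in>Basis - {b}. v d *\<^sub>R d) + y *\<^sub>R b +
        h (((\<Sum>d\<in>Basis - {b}. v d *\<^sub>R d) + y *\<^sub>R b) \<bullet> c) *\<^sub>R b) \<partial>lborel \<partial>(\<Pi>\<^sub>M c\<in>Basis - {b}. lborel))"
      using b(1) by (rule nn_integral_lborel_split) auto
    then show ?thesis
      by (simp only: eq) (simp add: scaleR_add_left add_ac)
  qed
  also have "\<dots> = (\<integral>\<^sup>+v. \<integral>\<^sup>+y. indicator A ((\<Sum>d\<in>Basis - {b}. v d *\<^sub>R d) + y *\<^sub>R b)
      \<partial>lborel \<partial>(\<Pi>\<^sub>M c\<in>Basis - {b}. lborel))"
  proof (rule nn_integral_cong)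
    fix v :: "'a \<Rightarrow> real"
    show "(\<integral>\<^sup>+y. indicator A ((\<Sum>d\<in>Basis - {b}. v d *\<^sub>R d) + (h (v c) + 1 * y) *\<^sub>R b) \<partial>lborel) =
        (\<integral>\<^sup>+y. indicator A ((\<Sum>d\<in>Basis - {b}. v d *\<^sub>R d) + y *\<^sub>R b) \<partial>lborel)"
      by (subst nn_integral_real_affine[where c = 1 and t = "h (v c)" and
            f = "\<lambda>y. indicator A ((\<Sum>d\<in>Basis - {b}. v d *\<^sub>R d) + y *\<^sub>R b)"]) auto
  qed
  also have "\<dots> = (\<integral>\<^sup>+x. indicator A x \<partial>lborel)"
    using b(1) by (subst nn_integral_lborel_split) simp_all
  finally show "emeasure (distr lborel borel (\<lambda>x. x + h (x \<bullet> c) *\<^sub>R b)) A = emeasure lborel A"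
    by simp
qed simp

lemma distr_lborel_shear_map:
  fixes \<phi> :: "real^'n::finite \<Rightarrow> real^'n"
  shows "shear_map K \<phi> \<Longrightarrow> distr lborel borel \<phi> = lborel"
proof (induction rule: shear_map.induct)
  case (shear i j k a)
  then have "(axis i 1 :: real^'n) \<noteq> axis j 1"
    by (simp add: axis_eq_axis)
  then have "distr lborel borel (\<lambda>x. x + (a * (x \<bullet> axis j 1) ^ k) *\<^sub>R (axis i 1 :: real^'n)) = lborel"
    by (intro distr_lborel_shear_Basis) auto
  then show ?case
    by (simp add: shear_def[abs_def] shear_field_def inner_axis)
next
  case (comp \<phi> \<psi>)
  then have [measurable]: "\<phi> \<in> borel_measurable borel" "\<psi> \<in> borel_measurable borel"
    by (auto intro: borel_measurable_continuous_onI continuous_on_shear_map)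
  have "distr lborel borel (\<phi> \<circ> \<psi>) = distr (distr lborel borel \<psi>) borel \<phi>"
    by (rule distr_distr[symmetric]) auto
  also have "\<dots> = lborel"
    by (simp only: comp.IH)
  finally show ?case .
qed

section \<open>Interpolation by shears\<close>

lemma shear_map_id:
  assumes "CARD('n::finite) \<ge> 2" "K \<noteq> {}"
  shows "shear_map K (\<lambda>x :: real^'n. x)"
proof -
  obtain i j :: 'n where "i \<noteq> j"
    using assms(1) card_le_Suc0_iff_eq[of "UNIV :: 'n set"] by force
  moreover obtain k where "k \<in> K"
    using assms(2) by blast
  ultimately show ?thesis
    using shear_map.shear[of i j k K 0] by (simp add: shear_def[abs_def] shear_field_def)
qed

text \<open>The last assumption says that no displacement sees the shift made by the others, so
  successive maps add their displacements instead of nesting them. The identity covers the empty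
  sum.\<close>

lemma shear_map_sum:
  fixes \<phi> :: "'i \<Rightarrow> real^'n \<Rightarrow> real^'n::finite"
  assumes "shear_map K (\<lambda>x :: real^'n. x)" "finite A"
    and "\<And>l. l \<in> A \<Longrightarrow> shear_map K (\<lambda>x. x + \<phi> l x)"
    and "\<And>B l x. B \<subseteq> A \<Longrightarrow> l \<in> A - B \<Longrightarrow> \<phi> l (x + (\<Sum>m\<in>B. \<phi> m x)) = \<phi> l x"
  shows "shear_map K (\<lambda>x. x + (\<Sum>l\<in>A. \<phi> l x))"
  using assms(2-4)
proof (induction A rule: finite_induct)
  case (insert l A)
  have "shear_map K (\<lambda>x. x + (\<Sum>l\<in>A. \<phi> l x))"
    by (rule insert.IH) (use insert.prems in blast)+
  from shear_map.comp[OF insert.prems(1)[of l] this]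
  have "shear_map K (\<lambda>x. x + (\<Sum>l\<in>A. \<phi> l x) + \<phi> l (x + (\<Sum>l\<in>A. \<phi> l x)))"
    by (simp add: comp_def)
  moreover have "\<phi> l (x + (\<Sum>l\<in>A. \<phi> l x)) = \<phi> l x" for x
    using insert.hyps insert.prems(2)[of A l] by blast
  ultimately show ?case
    using insert.hyps by (simp add: add_ac)
qed (use assms(1) in simp)

text \<open>Monomial shears with the same \<open>i\<close> and \<open>j\<close> read coordinate
  \<open>j\<close> and change only coordinate \<open>i\<close>, so their displacements add up.
  \<open>poly p 0 = 0\<close> removes the exponent 0.\<close>

lemma shear_map_poly:
  fixes i j :: "'n::finite"
  assumes "i \<noteq> j" "poly p 0 = 0"
  shows "shear_map {1..} (shear i j (poly p))"
proof -
  have 2: "CARD('n) \<ge> 2"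
    using assms(1) card_le_Suc0_iff_eq[of "UNIV :: 'n set"] by (metis UNIV_I finite not_less_eq_eq numeral_2_eq_2)
  have "shear_map {1..} (\<lambda>x. x + (\<Sum>k\<in>{1..degree p}. shear_field i j (\<lambda>s. coeff p k * s ^ k) x))"
  proof (rule shear_map_sum)
    show "shear_map {1..} (\<lambda>x. x + shear_field i j (\<lambda>s. coeff p k * s ^ k) x)"
      if "k \<in> {1..degree p}" for k
      using shear_map.shear[OF assms(1), of k "{1..}"] that by (simp add: shear_def[abs_def])
  qed (use assms(1) shear_map_id[OF 2, of "{1..}"] in \<open>auto simp: shear_field_def sum_component axis_def\<close>)
  also have "(\<lambda>x. x + (\<Sum>k\<in>{1..degree p}. shear_field i j (\<lambda>s. coeff p k * s ^ k) x)) = shear i j (poly p)"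
  proof
    fix x
    have "poly p s = (\<Sum>k\<in>{1..degree p}. coeff p k * s ^ k)" for s
      using assms(2) by (simp add: poly_altdef poly_0_coeff_0 sum.atMost_shift[of _ "degree p"] sum.atLeast1_atMost_eq)
    then show "x + (\<Sum>k\<in>{1..degree p}. shear_field i j (\<lambda>s. coeff p k * s ^ k) x) = shear i j (poly p) x"
      by (simp add: shear_def shear_field_def scaleR_sum_left)
  qed
  finally show ?thesis .
qed

text \<open>Newton interpolation with 0 as an extra node: the correction \<open>q\<close> vanishes
  at 0 and at all earlier nodes, but not at the new one, which is nonzero and distinct from
  them.\<close>

lemma poly_interpolation_zero:
  fixes s v :: "'i \<Rightarrow> 'a::field"
  assumes "finite I" "inj_on s I" "\<And>i. i \<in> I \<Longrightarrow> s i \<noteq> 0"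
  shows "\<exists>p. poly p 0 = 0 \<and> (\<forall>i\<in>I. poly p (s i) = v i)"
  using assms
proof (induction I rule: finite_induct)
  case (insert i I)
  then obtain p where p: "poly p 0 = 0" "\<forall>i\<in>I. poly p (s i) = v i"
    by auto
  define q where "q = [:0, 1:] * (\<Prod>l\<in>I. [:- s l, 1:])"
  have q: "poly q 0 = 0" "\<forall>l\<in>I. poly q (s l) = 0" "poly q (s i) \<noteq> 0"
    using insert by (auto simp: q_def poly_prod)
  show ?case
    using p q insert.hyps
    by (intro exI[of _ "p + smult ((v i - poly p (s i)) / poly q (s i)) q"]) auto
qed (auto intro: exI[of _ 0])

text \<open>The vectors orthogonal to some member of a finite set of nonzero vectors form a finite
  union of hyperplanes, a null set, so some \<open>a\<close> avoids it.\<close>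

lemma separating_functional:
  fixes S :: "(real^'n::finite) set"
  assumes "finite S" "0 \<notin> S"
  shows "\<exists>a. a $ j = 1 \<and> (\<forall>x\<in>S. a \<bullet> x \<noteq> 0)"
proof -
  \<comment> \<open>Adding \<open>axis j 1\<close> forces \<open>a $ j \<noteq> 0\<close>, so that
    \<open>a\<close> can be rescaled to \<open>a $ j = 1\<close>.\<close>
  have "negligible (\<Union>x\<in>insert (axis j 1) S. {a. x \<bullet> a = 0})"
    using assms by (intro negligible_Union) (auto intro!: negligible_hyperplane simp: axis_eq_0_iff)
  then obtain a where "a \<notin> (\<Union>x\<in>insert (axis j 1) S. {a. x \<bullet> a = 0})"
    by (metis UNIV_eq_I non_negligible_UNIV)
  then have "a $ j \<noteq> 0" "\<forall>x\<in>S. x \<bullet> a \<noteq> 0"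
    by (auto simp: inner_axis')
  then show ?thesis
    by (intro exI[of _ "(1 / a $ j) *\<^sub>R a"]) (auto simp: inner_commute)
qed

text \<open>Replace coordinate \<open>j\<close> by \<open>a \<bullet> x\<close> for a generic
  \<open>a\<close>. As \<open>a $ j = 1\<close>, this adds multiples of the other coordinates to
  coordinate \<open>j\<close>, that is, it composes linear shears. The inverse \<open>\<psi>\<close>
  later undoes the map on the target side.\<close>

lemma separating_shear_map:
  fixes X :: "(real^'n::finite) set"
  assumes "CARD('n) \<ge> 2" "finite X" "0 \<notin> X"
  obtains \<phi> \<psi> where "shear_map {1..} \<phi>" "shear_map {1..} \<psi>" "\<And>x. \<psi> (\<phi> x) = x"
    "inj_on (\<lambda>x. \<phi> x $ j) X" "\<And>x. x \<in> X \<Longrightarrow> \<phi> x $ j \<noteq> 0"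
proof -
  \<comment> \<open>Nonvanishing on \<open>X\<close> gives nonzero coordinates, nonvanishing on
    differences gives injectivity.\<close>
  define S where "S = X \<union> {x - y | x y. x \<in> X \<and> y \<in> X \<and> x \<noteq> y}"
  have "S \<subseteq> X \<union> (\<lambda>(x, y). x - y) ` (X \<times> X)"
    by (auto simp: S_def)
  then have "finite S" "0 \<notin> S"
    using assms(2,3) by (auto simp: S_def intro: finite_subset)
  then obtain a where a: "a $ j = 1" "\<And>x. x \<in> S \<Longrightarrow> a \<bullet> x \<noteq> 0"
    using separating_functional by metis
  \<comment> \<open>\<open>L (-1)\<close> inverts \<open>L 1\<close>, as neither changes the
    coordinates summed over.\<close>
  define L :: "real \<Rightarrow> real^'n \<Rightarrow> real^'n"
    where "L c x = x + (\<Sum>i\<in>-{j}. shear_field j i (\<lambda>s. (c * a $ i) * s) x)" for c x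
  have L: "shear_map {1..} (L c)" for c
    unfolding L_def[abs_def]
  proof (rule shear_map_sum)
    show "shear_map {1..} (\<lambda>x. x + shear_field j i (\<lambda>s. c * a $ i * s) x)" if "i \<in> -{j}" for i
      using shear_map.shear[of j i 1 "{1..}"] that by (simp add: shear_def[abs_def])
  qed (use shear_map_id[OF assms(1), of "{1..}"] in \<open>auto simp: shear_field_def sum_component axis_def\<close>)
  have nth: "L c x $ i = (if i = j then x $ j + c * (\<Sum>i\<in>-{j}. a $ i * x $ i) else x $ i)" for c x i
    by (simp add: L_def sum_component shear_field_def axis_def sum_distrib_left mult_ac)
  have "L (-1) (L 1 x) = x" for x
  proof -
    have "(\<Sum>i\<in>-{j}. a $ i * L 1 x $ i) = (\<Sum>i\<in>-{j}. a $ i * x $ i)"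
      by (intro sum.cong) (auto simp: nth)
    then show ?thesis
      by (simp add: vec_eq_iff nth)
  qed
  moreover have "L 1 x $ j = a \<bullet> x" for x
  proof -
    have "a \<bullet> x = a $ j * x $ j + (\<Sum>i\<in>-{j}. a $ i * x $ i)"
      unfolding inner_vec_def by (subst sum.remove[of _ j]) (auto simp: Compl_eq_Diff_UNIV)
    then show ?thesis
      by (simp add: nth a(1))
  qed
  moreover have "inj_on (\<lambda>x. a \<bullet> x) X"
  proof (rule inj_onI, rule ccontr)
    fix x y assume *: "x \<in> X" "y \<in> X" "a \<bullet> x = a \<bullet> y" "x \<noteq> y"
    then have "x - y \<in> S"
      by (auto simp: S_def)
    from a(2)[OF this] *(3) show False
      by (simp add: inner_diff_right)
  qed
  ultimately show ?thesis
    using that[of "L 1" "L (-1)"] L a(2) by (auto simp: S_def)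
qed

text \<open>Once the points are separated by coordinate \<open>j\<close> and the targets by coordinate \<open>i\<close>, two steps
  suffice: shears driven by coordinate \<open>j\<close> correct all other coordinates, then one shear driven by
  the corrected coordinate \<open>i\<close> corrects coordinate \<open>j\<close>.\<close>

lemma shear_map_interpolation_separated:
  fixes xs ys :: "'i \<Rightarrow> real^'n::finite"
  assumes "finite I" "i \<noteq> j"
    and "inj_on (\<lambda>k. xs k $ j) I" "\<And>k. k \<in> I \<Longrightarrow> xs k $ j \<noteq> 0"
    and "inj_on (\<lambda>k. ys k $ i) I" "\<And>k. k \<in> I \<Longrightarrow> ys k $ i \<noteq> 0"
  shows "\<exists>\<phi>. shear_map {1..} \<phi> \<and> (\<forall>k\<in>I. \<phi> (xs k) = ys k)"
proof -
  have 2: "CARD('n) \<ge> 2"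
    using assms(2) card_le_Suc0_iff_eq[of "UNIV :: 'n set"] by (metis UNIV_I finite not_less_eq_eq numeral_2_eq_2)
  have "\<forall>l. \<exists>p. poly p 0 = 0 \<and> (\<forall>k\<in>I. poly p (xs k $ j) = ys k $ l - xs k $ l)"
    by (intro allI poly_interpolation_zero) (use assms in auto)
  then obtain p where p: "\<And>l. poly (p l) 0 = 0"
    "\<And>l k. k \<in> I \<Longrightarrow> poly (p l) (xs k $ j) = ys k $ l - xs k $ l"
    by metis
  obtain q where q: "poly q 0 = 0" "\<And>k. k \<in> I \<Longrightarrow> poly q (ys k $ i) = ys k $ j - xs k $ j"
    using poly_interpolation_zero[of I "\<lambda>k. ys k $ i" "\<lambda>k. ys k $ j - xs k $ j"] assms(1,5,6) by blast
  define \<phi> where "\<phi> x = x + (\<Sum>l\<in>-{j}. shear_field l j (poly (p l)) x)" for x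
  have "shear_map {1..} \<phi>"
    unfolding \<phi>_def[abs_def]
  proof (rule shear_map_sum)
    show "shear_map {1..} (\<lambda>x. x + shear_field l j (poly (p l)) x)" if "l \<in> -{j}" for l
      using shear_map_poly[of l j "p l"] that p(1) by (simp add: shear_def[abs_def])
    show "shear_field l j (poly (p l)) (x + (\<Sum>m\<in>B. shear_field m j (poly (p m)) x)) =
        shear_field l j (poly (p l)) x" if "B \<subseteq> -{j}" for B l x
    proof -
      have "(\<Sum>m\<in>B. shear_field m j (poly (p m)) x) $ j = 0"
        using that by (auto simp: sum_component shear_field_def axis_def intro!: sum.neutral)
      then show ?thesis
        by (simp add: shear_field_def)
    qed
  qed (use shear_map_id[OF 2, of "{1..}"] in auto)
  moreover have "shear_map {1..} (shear j i (poly q))"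
    using shear_map_poly assms(2) q(1) by metis
  ultimately have "shear_map {1..} (shear j i (poly q) \<circ> \<phi>)"
    by (rule shear_map.comp[rotated])
  moreover have "(shear j i (poly q) \<circ> \<phi>) (xs k) = ys k" if k: "k \<in> I" for k
  proof -
    have "\<phi> (xs k) $ l = (if l = j then xs k $ j else ys k $ l)" for l
    proof -
      have "\<phi> (xs k) $ l = xs k $ l + (\<Sum>m\<in>-{j}. if l = m then poly (p m) (xs k $ j) else 0)"
        by (simp add: \<phi>_def sum_component shear_field_def axis_def if_distrib cong: if_cong)
      then show ?thesis
        using k p(2) by simp
    qed
    then show ?thesis
      using k q(2) assms(2) by (auto simp: vec_eq_iff shear_nth)
  qed
  ultimately show ?thesis
    by blast
qed

text \<open>The map \<open>\<alpha>\<close> makes the sources distinct and nonzero in coordinate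
  \<open>j\<close>, \<open>\<beta>\<close> the targets in coordinate \<open>i\<close>; interpolate
  between the images and undo \<open>\<beta>\<close> by its inverse \<open>\<beta>'\<close>.\<close>

lemma shear_map_interpolation:
  fixes xs ys :: "'i \<Rightarrow> real^'n::finite"
  assumes "CARD('n) \<ge> 2" "finite I" "inj_on xs I" "inj_on ys I" "0 \<notin> xs ` I" "0 \<notin> ys ` I"
  shows "\<exists>\<phi>. shear_map {1..} \<phi> \<and> (\<forall>k\<in>I. \<phi> (xs k) = ys k)"
proof -
  obtain i j :: 'n where ij: "i \<noteq> j"
    using assms(1) card_le_Suc0_iff_eq[of "UNIV :: 'n set"] by force
  obtain \<alpha> \<alpha>' where \<alpha>: "shear_map {1..} \<alpha>" "inj_on (\<lambda>x. \<alpha> x $ j) (xs ` I)"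
    "\<And>x. x \<in> xs ` I \<Longrightarrow> \<alpha> x $ j \<noteq> 0"
    by (rule separating_shear_map[of "xs ` I" j]) (use assms in auto)
  obtain \<beta> \<beta>' where \<beta>: "shear_map {1..} \<beta>'" "\<And>x. \<beta>' (\<beta> x) = x" "inj_on (\<lambda>x. \<beta> x $ i) (ys ` I)"
    "\<And>x. x \<in> ys ` I \<Longrightarrow> \<beta> x $ i \<noteq> 0"
    by (rule separating_shear_map[of "ys ` I" i]) (use assms in auto)
  obtain \<phi> where \<phi>: "shear_map {1..} \<phi>" "\<forall>k\<in>I. \<phi> (\<alpha> (xs k)) = \<beta> (ys k)"
    using shear_map_interpolation_separated[OF assms(2) ij, of "\<lambda>k. \<alpha> (xs k)" "\<lambda>k. \<beta> (ys k)"]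
      \<alpha>(2,3) \<beta>(3,4) comp_inj_on[OF assms(3) \<alpha>(2)] comp_inj_on[OF assms(4) \<beta>(3)]
    by (auto simp: comp_def)
  have "shear_map {1..} (\<beta>' \<circ> (\<phi> \<circ> \<alpha>))"
    using \<alpha>(1) \<beta>(1) \<phi>(1) by (intro shear_map.comp)
  then show ?thesis
    using \<phi>(2) \<beta>(2) by (intro exI[of _ "\<beta>' \<circ> (\<phi> \<circ> \<alpha>)"]) auto
qed

section \<open>The sine flow\<close>

text \<open>The odd multiple of pi, hence stable equilibrium of \<open>u' = sin u\<close>, in the
  middle of the half-open cell between consecutive even multiples, the unstable equilibria.\<close>

definition cell_center :: "real \<Rightarrow> real" where
  "cell_center s = 2 * pi * of_int \<lfloor>s / (2 * pi)\<rfloor> + pi"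

text \<open>The substitution \<open>\<tau> = tan (v / 2)\<close> linearises \<open>v' = - sin v\<close>, which is \<open>u' = sin u\<close> for
  \<open>v = u - cell_center u\<close>. The case distinction isolates the unstable equilibria, where \<open>tan\<close> takes
  a junk value.\<close>

definition sine_flow :: "real \<Rightarrow> real \<Rightarrow> real" where
  "sine_flow t s = (if sin (s / 2) = 0 then s
     else cell_center s + 2 * arctan (exp (- t) * tan ((s - cell_center s) / 2)))"

lemma cell_center_bounds: "cell_center s - pi \<le> s" "s < cell_center s + pi"
proof -
  have "of_int \<lfloor>s / (2 * pi)\<rfloor> * (2 * pi) \<le> s" "s < (of_int \<lfloor>s / (2 * pi)\<rfloor> + 1) * (2 * pi)"
    by (simp_all flip: pos_le_divide_eq pos_divide_less_eq)
  then show "cell_center s - pi \<le> s" "s < cell_center s + pi"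
    by (simp_all add: cell_center_def algebra_simps)
qed

lemma sin_half_cell_center: "sin ((cell_center s - pi) / 2) = 0"
  by (simp add: cell_center_def mult.commute)

text \<open>Away from the unstable equilibria the lower bound is strict, so
  \<open>(s - cell_center s) / 2\<close> lies strictly between -pi/2 and pi/2, where
  \<open>arctan\<close> inverts \<open>tan\<close>.\<close>

lemma cell_center_less:
  assumes "sin (s / 2) \<noteq> 0"
  shows "cell_center s - pi < s"
  using cell_center_bounds(1)[of s] sin_half_cell_center[of s] assms by (cases "s = cell_center s - pi") auto

text \<open>An odd multiple of pi cannot be 0. This keeps grid centres off the origin, which shears
  with exponents \<open>{1..}\<close> fix.\<close>

lemma cell_center_nonzero: "cell_center s \<noteq> 0"
proof
  assume "cell_center s = 0"
  then have "pi * of_int (2 * \<lfloor>s / (2 * pi)\<rfloor> + 1) = 0"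
    by (simp add: cell_center_def algebra_simps)
  then have "2 * \<lfloor>s / (2 * pi)\<rfloor> + 1 = 0"
    by (metis mult_eq_0_iff of_int_eq_0_iff pi_neq_zero)
  then show False
    by presburger
qed

lemma sin_cell_center_add: "sin (cell_center s + x) = - sin x"
proof -
  have "sin (cell_center s + x) = sin (x + pi + 2 * pi * of_int \<lfloor>s / (2 * pi)\<rfloor>)"
    by (simp add: cell_center_def algebra_simps)
  also have "\<dots> = sin (x + pi)"
    by (subst sin_add) (simp add: sin_int_2pin cos_int_2pin)
  finally show ?thesis
    by simp
qed

lemma sine_flow_0: "sine_flow 0 s = s"
  using cell_center_less[of s] cell_center_bounds(2)[of s]
  by (auto simp: sine_flow_def arctan_tan field_simps)

lemma sin_eq_0_half: "sin (s / 2) = 0 \<Longrightarrow> sin s = 0" for s :: real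
  using sin_double[of "s / 2"] by simp

text \<open>Both sides equal \<open>- 2 * \<tau> / (1 + \<tau>\<^sup>2)\<close> with
  \<open>\<tau> = exp (- t) * T\<close>: the double-angle formula gives the sine, the chain rule the
  derivative. At an unstable equilibrium the trajectory is constant.\<close>

lemma sine_flow_DERIV: "((\<lambda>t. sine_flow t s) has_real_derivative sin (sine_flow t s)) (at t within S)"
proof (cases "sin (s / 2) = 0")
  case True
  then show ?thesis
    by (simp add: sine_flow_def sin_eq_0_half)
next
  case False
  define T where "T = tan ((s - cell_center s) / 2)"
  define \<tau> where "\<tau> = exp (- t) * T"
  have pos: "1 + \<tau>\<^sup>2 > 0"
    by (smt (verit) zero_le_power2)
  have "sin (sine_flow t s) = - sin (2 * arctan \<tau>)"
    using False by (simp add: sine_flow_def sin_cell_center_add \<tau>_def T_def)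
  also have "\<dots> = - 2 * \<tau> / (1 + \<tau>\<^sup>2)"
    using pos by (simp add: sin_double sin_arctan cos_arctan)
  finally have *: "sin (sine_flow t s) = - 2 * \<tau> / (1 + \<tau>\<^sup>2)" .
  have "((\<lambda>t. cell_center s + 2 * arctan (exp (- t) * T)) has_real_derivative - 2 * \<tau> / (1 + \<tau>\<^sup>2)) (at t within S)"
    using pos by (auto intro!: derivative_eq_intros simp: \<tau>_def divide_simps)
  moreover have "(\<lambda>t. sine_flow t s) = (\<lambda>t. cell_center s + 2 * arctan (exp (- t) * T))"
    using False by (simp add: sine_flow_def T_def)
  ultimately show ?thesis
    by (simp only: *)
qed

text \<open>Trajectories never leave the closure of their cell. The bound is uniform in
  \<open>t\<close> and later supplies the domination.\<close>

lemma sine_flow_bound: "\<bar>sine_flow t s - cell_center s\<bar> \<le> pi"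
  using cell_center_bounds[of s] arctan_bounded[of "exp (- t) * tan ((s - cell_center s) / 2)"]
  by (auto simp: sine_flow_def abs_le_iff)

lemma sine_flow_tendsto:
  assumes "sin (s / 2) \<noteq> 0"
  shows "(\<lambda>n. sine_flow (real n) s) \<longlonglongrightarrow> cell_center s"
proof -
  have "(\<lambda>n. exp (- real n)) \<longlonglongrightarrow> 0"
    by real_asymp
  then have "(\<lambda>n. cell_center s + 2 * arctan (exp (- real n) * tan ((s - cell_center s) / 2)))
      \<longlonglongrightarrow> cell_center s + 2 * arctan (0 * tan ((s - cell_center s) / 2))"
    by (intro tendsto_intros)
  then show ?thesis
    using assms by (simp add: sine_flow_def)
qed

section \<open>The sine flow on \<open>real^'n\<close> and its grid\<close>

definition sine_field :: "real \<Rightarrow> real^'n \<Rightarrow> real^'n::finite" where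
  "sine_field w x = (\<chi> i. w * sin (x $ i / w))"

definition sine_map :: "real \<Rightarrow> real \<Rightarrow> real^'n \<Rightarrow> real^'n::finite" where
  "sine_map w t x = (\<chi> i. w * sine_flow t (x $ i / w))"

definition grid_center :: "real \<Rightarrow> real^'n \<Rightarrow> real^'n::finite" where
  "grid_center w x = (\<chi> i. w * cell_center (x $ i / w))"

lemma local_lipschitz_sine_field:
  "local_lipschitz (UNIV::real set) UNIV (\<lambda>_. sine_field w :: real^'n \<Rightarrow> real^'n::finite)"
proof (rule local_lipschitz_autonomousI)
  fix x :: "real^'n"
  have 1: "\<bar>sin a - sin b\<bar> \<le> \<bar>a - b\<bar>" for a b :: real
  proof -
    have "\<bar>sin a - sin b\<bar> = 2 * \<bar>sin ((a - b) / 2)\<bar> * \<bar>cos ((a + b) / 2)\<bar>"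
      by (simp add: sin_diff_sin abs_mult)
    also have "\<dots> \<le> 2 * \<bar>(a - b) / 2\<bar> * 1"
      by (intro mult_mono abs_sin_x_le_abs_x) auto
    finally show ?thesis
      by simp
  qed
  have "norm (sine_field w y - sine_field w z) \<le> norm (y - z)" for y z :: "real^'n"
  proof (rule norm_le_componentwise_cart)
    fix i
    have "\<bar>w\<bar> * \<bar>sin (y $ i / w) - sin (z $ i / w)\<bar> \<le> \<bar>w\<bar> * \<bar>y $ i / w - z $ i / w\<bar>"
      using 1 by (intro mult_left_mono) auto
    then have "\<bar>w * (sin (y $ i / w) - sin (z $ i / w))\<bar> \<le> \<bar>w * (y $ i / w - z $ i / w)\<bar>"
      by (simp add: abs_mult)
    then show "norm ((sine_field w y - sine_field w z) $ i) \<le> norm ((y - z) $ i)"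
      by (cases "w = 0") (simp_all add: sine_field_def right_diff_distrib)
  qed
  then have "1-lipschitz_on (cball x 1) (sine_field w)"
    by (intro lipschitz_onI) (auto simp: dist_norm)
  then show "\<exists>L. L-lipschitz_on (cball x 1) (sine_field w)"
    by blast
qed

lemma is_solution_sine_field:
  assumes "w \<noteq> 0"
  shows "is_solution (sine_field w) x t (\<lambda>s. sine_map w s x)"
  unfolding is_solution_def
proof (intro conjI ballI)
  show "sine_map w 0 x = x"
    using assms by (simp add: sine_map_def sine_flow_0)
  fix s
  have sum: "(\<chi> i. f i) = (\<Sum>i\<in>UNIV. f i *\<^sub>R axis i 1)" for f :: "'a \<Rightarrow> real"
    using basis_expansion[of "\<chi> i. f i"] by (simp add: scalar_mult_eq_scaleR)
  have "((\<lambda>s. \<Sum>i\<in>UNIV. (w * sine_flow s (x $ i / w)) *\<^sub>R axis i (1::real)) has_vector_derivative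
      (\<Sum>i\<in>UNIV. (w * sin (sine_flow s (x $ i / w))) *\<^sub>R axis i 1)) (at s within {0..t})"
    by (auto intro!: derivative_eq_intros sine_flow_DERIV simp: mult.commute)
  moreover have "sine_field w (sine_map w s x) = (\<chi> i. w * sin (sine_flow s (x $ i / w)))"
    using assms by (simp add: sine_field_def sine_map_def)
  ultimately show "((\<lambda>s. sine_map w s x) has_vector_derivative sine_field w (sine_map w s x)) (at s within {0..t})"
    by (simp only: sine_map_def sum)
qed

lemma flow_sine_field:
  fixes x :: "real^'n::finite"
  assumes "w \<noteq> 0" "0 \<le> t"
  shows "flow (sine_field w) t x = sine_map w t x"
  using flow_eqI[OF local_lipschitz_sine_field is_solution_sine_field[OF assms(1)] assms(2)] .

lemma norm_grid_center_diff_le: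
  fixes y :: "real^'n::finite"
  assumes "0 < w" "\<And>i. \<bar>y $ i / w - cell_center (x $ i / w)\<bar> \<le> pi"
  shows "norm (y - grid_center w x) \<le> CARD('n) * (w * pi)"
proof -
  have "norm (y - grid_center w x) \<le> (\<Sum>i\<in>UNIV. \<bar>(y - grid_center w x) $ i\<bar>)"
    by (rule norm_le_l1_cart)
  also have "\<dots> \<le> (\<Sum>i\<in>(UNIV :: 'n set). w * pi)"
  proof (rule sum_mono)
    fix i
    have "\<bar>(y - grid_center w x) $ i\<bar> = w * \<bar>y $ i / w - cell_center (x $ i / w)\<bar>"
      using assms(1) by (simp add: grid_center_def field_simps flip: abs_mult_pos')
    then show "\<bar>(y - grid_center w x) $ i\<bar> \<le> w * pi"
      using assms by (simp add: mult_left_mono)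
  qed
  finally show ?thesis
    by simp
qed

lemma norm_diff_grid_center:
  fixes x :: "real^'n::finite"
  assumes "0 < w"
  shows "norm (x - grid_center w x) \<le> CARD('n) * (w * pi)"
    and "norm (sine_map w t x - grid_center w x) \<le> CARD('n) * (w * pi)"
proof -
  have "\<bar>x $ i / w - cell_center (x $ i / w)\<bar> \<le> pi" for i
    using cell_center_bounds[of "x $ i / w"] by linarith
  then show "norm (x - grid_center w x) \<le> CARD('n) * (w * pi)"
    by (rule norm_grid_center_diff_le[OF assms])
  show "norm (sine_map w t x - grid_center w x) \<le> CARD('n) * (w * pi)"
    by (rule norm_grid_center_diff_le[OF assms]) (use assms sine_flow_bound in \<open>simp add: sine_map_def\<close>)
qed

lemma grid_center_nonzero: "w \<noteq> 0 \<Longrightarrow> grid_center w x \<noteq> 0"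
  by (simp add: grid_center_def vec_eq_iff cell_center_nonzero)

lemma finite_grid_center:
  fixes K :: "(real^'n::finite) set"
  assumes "0 < w" "bounded K"
  shows "finite (grid_center w ` K)"
proof -
  obtain R where R: "\<And>x. x \<in> K \<Longrightarrow> norm x \<le> R"
    using assms(2) by (auto simp: bounded_iff)
  define A where "A = (\<lambda>k. w * (2 * pi * of_int k + pi)) ` {\<lfloor>- R / w / (2 * pi)\<rfloor>..\<lfloor>R / w / (2 * pi)\<rfloor>}"
  have "grid_center w ` K \<subseteq> vec_lambda ` (UNIV \<rightarrow>\<^sub>E A)"
  proof clarify
    fix x assume "x \<in> K"
    then have "\<bar>x $ i\<bar> \<le> R" for i
      using R component_le_norm_cart order_trans by blast
    then have "- R \<le> x $ i" "x $ i \<le> R" for i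
      by (simp_all add: abs_le_iff minus_le_iff)
    then have "- R / w / (2 * pi) \<le> x $ i / w / (2 * pi)" "x $ i / w / (2 * pi) \<le> R / w / (2 * pi)" for i
      using assms(1) by (intro divide_right_mono; simp)+
    then have "\<lfloor>x $ i / w / (2 * pi)\<rfloor> \<in> {\<lfloor>- R / w / (2 * pi)\<rfloor>..\<lfloor>R / w / (2 * pi)\<rfloor>}" for i
      by (simp only: atLeastAtMost_iff floor_mono simp_thms)
    then have "(\<lambda>i. w * cell_center (x $ i / w)) \<in> UNIV \<rightarrow>\<^sub>E A"
      unfolding A_def cell_center_def by blast
    then show "grid_center w x \<in> vec_lambda ` (UNIV \<rightarrow>\<^sub>E A)"
      unfolding grid_center_def by blast
  qed
  moreover have "finite (UNIV \<rightarrow>\<^sub>E A :: ('n \<Rightarrow> real) set)"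
    by (intro finite_PiE) (auto simp: A_def)
  ultimately show ?thesis
    by (meson finite_imageI finite_subset)
qed

lemma borel_measurable_componentwise:
  fixes f :: "real \<Rightarrow> real"
  assumes "f \<in> borel_measurable borel"
  shows "(\<lambda>x. \<chi> i. f (x $ i)) \<in> borel_measurable (borel :: (real^'n::finite) measure)"
proof (rule iffD2[OF borel_measurable_euclidean_space], intro ballI)
  fix b :: "real^'n"
  assume "b \<in> Basis"
  then obtain i where b: "b = axis i 1"
    by (auto simp: Basis_vec_def)
  have "(\<lambda>x :: real^'n. x $ i) \<in> borel_measurable borel"
    by measurable
  then show "(\<lambda>x. (\<chi> i. f (x $ i)) \<bullet> b) \<in> borel_measurable borel"
    using measurable_compose[of "\<lambda>x :: real^'n. x $ i" borel borel f borel] assms by (simp add: b inner_axis)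
qed

lemma borel_measurable_cell_center [measurable]: "cell_center \<in> borel_measurable borel"
  unfolding cell_center_def[abs_def] by measurable

lemma borel_measurable_sine_flow [measurable]: "sine_flow t \<in> borel_measurable borel"
  unfolding sine_flow_def[abs_def] tan_def by measurable

lemma borel_measurable_grid_center [measurable]: "grid_center w \<in> borel_measurable borel"
  unfolding grid_center_def[abs_def] by (intro borel_measurable_componentwise) measurable

lemma borel_measurable_sine_map [measurable]: "sine_map w t \<in> borel_measurable borel"
  unfolding sine_map_def[abs_def] by (intro borel_measurable_componentwise) measurable

text \<open>Convergence can fail only if some coordinate is an even multiple of
  \<open>w * pi\<close>: countably many hyperplanes, a null set.\<close>

lemma AE_sine_map_tendsto:
  assumes "w \<noteq> 0"
  shows "AE x in lborel. (\<lambda>n. sine_map w (real n) x) \<longlonglongrightarrow> grid_center w (x :: real^'n::finite)"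
proof -
  have "AE x in lborel. \<forall>i. \<forall>k::int. x \<bullet> axis i (1::real) \<noteq> w * (2 * of_int k * pi)"
    unfolding AE_all_countable by (intro allI AE_lborel_inner_neq) (simp add: axis_in_Basis_iff)
  then show ?thesis
  proof (rule AE_mp, intro AE_I2 impI)
    fix x :: "real^'n"
    assume *: "\<forall>i. \<forall>k::int. x \<bullet> axis i 1 \<noteq> w * (2 * of_int k * pi)"
    have "sin (x $ i / w / 2) \<noteq> 0" for i
    proof
      assume "sin (x $ i / w / 2) = 0"
      then obtain k :: int where "x $ i / w / 2 = of_int k * pi"
        by (auto simp: sin_zero_iff_int2)
      then have "x $ i = w * (2 * of_int k * pi)"
        using assms by (simp add: field_simps)
      then show False
        using * by (simp add: inner_axis)
    qed
    then show "(\<lambda>n. sine_map w (real n) x) \<longlonglongrightarrow> grid_center w x"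
      unfolding sine_map_def grid_center_def by (intro tendsto_intros sine_flow_tendsto)
  qed
qed

section \<open>Approximation and volume preservation\<close>

text \<open>Shear maps are injective and, with exponents \<open>{1..}\<close>, fix 0, so values of
  \<open>G\<close> that coincide or vanish must be moved slightly; every ball has infinitely many
  points to choose from.\<close>

lemma perturb_inj_on:
  fixes G :: "'a \<Rightarrow> 'b::euclidean_space"
  assumes "finite C" "0 < \<eta>"
  shows "\<exists>y. inj_on y C \<and> 0 \<notin> y ` C \<and> (\<forall>c\<in>C. dist (G c) (y c) < \<eta>)"
  using assms(1)
proof (induction C rule: finite_induct)
  case (insert c C)
  then obtain y where y: "inj_on y C" "0 \<notin> y ` C" "\<forall>c\<in>C. dist (G c) (y c) < \<eta>"
    by blast
  have "infinite (ball (G c) \<eta>)"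
    using assms(2) uncountable_ball countable_finite by blast
  then have "infinite (ball (G c) \<eta> - insert 0 (y ` C))"
    using insert.hyps(1) by (intro Diff_infinite_finite) auto
  then obtain z where z: "z \<in> ball (G c) \<eta> - insert 0 (y ` C)"
    by (metis finite.emptyI ex_in_conv)
  have eq: "(y(c := z)) ` insert c C = insert z (y ` C)"
    using insert.hyps(2) by (auto simp: image_iff)
  have "inj_on (y(c := z)) (insert c C)"
    using y(1) z insert.hyps(2) by (auto simp: inj_on_def)
  moreover have "0 \<notin> (y(c := z)) ` insert c C"
    unfolding eq using y(2) z by auto
  moreover have "\<forall>d\<in>insert c C. dist (G d) ((y(c := z)) d) < \<eta>"
    using y(3) z by auto
  ultimately show ?case
    by blast
qed simp

lemma shear_map_sine_map_attainable:
  fixes F :: "(real^'n \<Rightarrow> real^'n::finite) set"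
  assumes "monomial_shears {1..} \<subseteq> F" "sine_field w \<in> F" "w \<noteq> 0" "0 \<le> t" "shear_map {1..} \<psi>"
  shows "attainable_on F S (\<lambda>x. \<psi> (sine_map w t x))"
proof -
  have eq: "flow (sine_field w) t = sine_map w t"
    using flow_sine_field[OF assms(3,4)] by blast
  have "attainable_on F UNIV (flow (sine_field w) t)"
    using assms is_solution_sine_field[OF assms(3)]
    by (intro attainable_on_flow) (auto simp: flow_exists_def)
  from attainable_on_UNIV_comp[OF this attainable_on_mono[OF shear_map_attainable[OF assms(5)] assms(1)]]
  show ?thesis
    unfolding eq comp_def by (rule attainable_on_mono) simp
qed

text \<open>The sine flow contracts almost every point of \<open>K\<close> to the centre of its grid cell; an
  interpolating shear map then sends the finitely many centres to the required values, and
  dominated convergence controls the transition layer.\<close>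

lemma Lp_close_shear_map_sine_map:
  fixes G :: "real^'n \<Rightarrow> real^'n::finite"
  assumes "CARD('n) \<ge> 2" "1 \<le> p" and G: "continuous_on UNIV G" and K: "compact K" and "0 < \<epsilon>"
  shows "\<exists>w>0. \<exists>t\<ge>0. \<exists>\<psi>. shear_map {1..} \<psi> \<and> Lp_close p K G (\<lambda>x. \<psi> (sine_map w t x)) \<epsilon>"
proof -
  obtain R where R: "\<And>x. x \<in> K \<Longrightarrow> norm x \<le> R" "0 < R"
    using compact_imp_bounded[OF K] by (auto simp: bounded_pos)
  \<comment> \<open>Centres lie within 1 of the points of \<open>K\<close>, and trajectories within
    1 of the centres; the margin 2 keeps both in \<open>B\<close>.\<close>
  define B :: "(real^'n) set" where "B = cball 0 (R + 2)"
  have B: "compact B"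
    by (simp add: B_def)
  have Kb [measurable]: "K \<in> sets borel"
    using K by (simp add: borel_compact)
  have Gm [measurable]: "G \<in> borel_measurable borel"
    using G by (rule borel_measurable_continuous_onI)
  define m where "m = measure lborel K"
  have m: "emeasure lborel K = ennreal m" "0 \<le> m"
    using emeasure_compact_finite[OF K] by (simp_all add: m_def emeasure_eq_ennreal_measure less_top)
  \<comment> \<open>As \<open>m + 2 \<ge> 1\<close>, \<open>(m + 2) powr p \<ge> m + 2\<close>; a
    pointwise error of at most \<open>2 * \<eta> = \<epsilon> / (m + 2)\<close> thus has integral at
    most \<open>\<epsilon> powr p * m / (m + 2)\<close>.\<close>
  define \<eta> where "\<eta> = \<epsilon> / (m + 2) / 2"
  have "\<eta> > 0"
    using assms(5) m(2) by (simp add: \<eta>_def)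
  have small: "(2 * \<eta>) powr p * m < \<epsilon> powr p"
  proof -
    have "2 * \<eta> = \<epsilon> / (m + 2)"
      using m(2) by (simp add: \<eta>_def field_simps)
    then have "(2 * \<eta>) powr p = \<epsilon> powr p / (m + 2) powr p"
      using m(2) assms(5) by (simp only: powr_divide)
    also have "\<dots> \<le> \<epsilon> powr p / (m + 2)"
      using powr_mono[OF assms(2), of "m + 2"] m(2) by (intro divide_left_mono) auto
    finally have "(2 * \<eta>) powr p * m \<le> \<epsilon> powr p / (m + 2) * m"
      using m(2) by (rule mult_right_mono)
    also have "\<dots> < \<epsilon> powr p"
      using m(2) assms(5) by (simp add: field_simps)
    finally show ?thesis .
  qed
  obtain \<delta> where \<delta>: "0 < \<delta>" "\<And>x y. x \<in> B \<Longrightarrow> y \<in> B \<Longrightarrow> dist x y < \<delta> \<Longrightarrow> dist (G x) (G y) < \<eta>"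
    using compact_uniformly_continuous[OF continuous_on_subset[OF G] B] \<open>\<eta> > 0\<close>
    unfolding uniformly_continuous_on_def by (metis dist_commute subset_UNIV)
  \<comment> \<open>Makes the distance bound \<open>CARD('n) * (w * pi)\<close> half of
    \<open>min \<delta> 1\<close>, below both.\<close>
  define w where "w = min \<delta> 1 / (2 * CARD('n) * pi)"
  have w: "0 < w"
    using \<delta>(1) by (simp add: w_def)
  have "CARD('n) * (w * pi) = min \<delta> 1 / 2"
    by (simp add: w_def)
  then have wn: "CARD('n) * (w * pi) < \<delta>" "CARD('n) * (w * pi) < 1"
    using \<delta>(1) by auto
  have center: "dist x (grid_center w x) < \<delta>" "dist x (grid_center w x) < 1"
    "dist (sine_map w t x) (grid_center w x) < 1" for x :: "real^'n" and t
    using norm_diff_grid_center(1)[OF w, of x] norm_diff_grid_center(2)[OF w, of t x] wn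
    unfolding dist_norm by linarith+
  have inB: "x \<in> B" "grid_center w x \<in> B" "sine_map w t x \<in> B" if "x \<in> K" for x t
  proof -
    have "norm x \<le> R"
      using R(1) that .
    then show "x \<in> B" "grid_center w x \<in> B" "sine_map w t x \<in> B"
      using center(2)[of x] center(3)[of t x]
      unfolding B_def mem_cball by norm+
  qed
  define C where "C = grid_center w ` K"
  have "finite C"
    unfolding C_def using w compact_imp_bounded[OF K] by (rule finite_grid_center)
  then obtain y where y: "inj_on y C" "0 \<notin> y ` C" "\<And>c. c \<in> C \<Longrightarrow> dist (G c) (y c) < \<eta>"
    using perturb_inj_on[OF _ \<open>\<eta> > 0\<close>, of C G] by blast
  have "\<exists>\<psi>. shear_map {1..} \<psi> \<and> (\<forall>c\<in>C. \<psi> c = y c)"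
    using shear_map_interpolation[OF assms(1) \<open>finite C\<close>, of "\<lambda>c. c" y] y(1,2) w
    by (force simp: C_def grid_center_nonzero)
  then obtain \<psi> where \<psi>: "shear_map {1..} \<psi>" "\<And>c. c \<in> C \<Longrightarrow> \<psi> c = y c"
    by blast
  have c\<psi>: "continuous_on UNIV \<psi>"
    using \<psi>(1) by (rule continuous_on_shear_map)
  then have [measurable]: "\<psi> \<in> borel_measurable borel"
    by (rule borel_measurable_continuous_onI)
  have "bounded (G ` B)" "bounded (\<psi> ` B)"
    using B G c\<psi> by (meson compact_continuous_image compact_imp_bounded continuous_on_subset subset_UNIV)+
  then obtain M1 M2 where M: "\<And>x. x \<in> B \<Longrightarrow> norm (G x) \<le> M1" "\<And>x. x \<in> B \<Longrightarrow> norm (\<psi> x) \<le> M2"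
    unfolding bounded_iff by (meson imageI)
  define u where "u n x = indicator K x * ennreal (norm (G x - \<psi> (sine_map w (real n) x)) powr p)" for n x
  define v where "v x = indicator K x * ennreal (norm (G x - \<psi> (grid_center w x)) powr p)" for x
  have "(\<lambda>n. \<integral>\<^sup>+x. u n x \<partial>lborel) \<longlonglongrightarrow> (\<integral>\<^sup>+x. v x \<partial>lborel)"
  proof (rule nn_integral_dominated_convergence)
    show "u n \<in> borel_measurable lborel" for n
      unfolding u_def by measurable
    show "v \<in> borel_measurable lborel"
      unfolding v_def by measurable
    show "(\<lambda>x. indicator K x * ennreal ((M1 + M2) powr p)) \<in> borel_measurable lborel"
      by measurable
    show "(\<integral>\<^sup>+x. indicator K x * ennreal ((M1 + M2) powr p) \<partial>lborel) < \<infinity>"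
      by (subst nn_integral_multc) (auto simp: m ennreal_mult_less_top)
    show "AE x in lborel. u n x \<le> indicator K x * ennreal ((M1 + M2) powr p)" for n
    proof (rule AE_I2)
      fix x :: "real^'n"
      show "u n x \<le> indicator K x * ennreal ((M1 + M2) powr p)"
      proof (cases "x \<in> K")
        case True
        then have "norm (G x - \<psi> (sine_map w (real n) x)) \<le> M1 + M2"
          using M inB by (meson add_mono norm_triangle_ineq4 order_trans)
        then show ?thesis
          using assms(2) True by (auto simp: u_def intro!: ennreal_leI powr_mono2)
      qed (simp add: u_def)
    qed
    show "AE x in lborel. (\<lambda>n. u n x) \<longlonglongrightarrow> v x"
      using AE_sine_map_tendsto[OF less_imp_neq[OF w, symmetric]]
    proof (rule AE_mp, intro AE_I2 impI)
      fix x :: "real^'n"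
      assume x: "(\<lambda>n. sine_map w (real n) x) \<longlonglongrightarrow> grid_center w x"
      have "(\<lambda>n. \<psi> (sine_map w (real n) x)) \<longlonglongrightarrow> \<psi> (grid_center w x)"
        using continuous_on_tendsto_compose[OF c\<psi> x] by simp
      \<comment> \<open>The base may tend to 0; the positive exponent keeps \<open>powr\<close>
        continuous there.\<close>
      then have "(\<lambda>n. norm (G x - \<psi> (sine_map w (real n) x)) powr p)
          \<longlonglongrightarrow> norm (G x - \<psi> (grid_center w x)) powr p"
        using assms(2) by (intro tendsto_powr' tendsto_intros) auto
      then show "(\<lambda>n. u n x) \<longlonglongrightarrow> v x"
        unfolding u_def v_def by (intro ennreal_tendsto_cmult tendsto_ennrealI) (auto simp: indicator_def)
    qed
  qed
  moreover have "(\<integral>\<^sup>+x. v x \<partial>lborel) < ennreal (\<epsilon> powr p)"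
  proof -
    have "v x \<le> indicator K x * ennreal ((2 * \<eta>) powr p)" for x
    proof (cases "x \<in> K")
      case True
      then have c: "grid_center w x \<in> C"
        by (simp add: C_def)
      have "dist (G x) (G (grid_center w x)) < \<eta>"
        using inB[OF True] center(1) by (intro \<delta>(2))
      \<comment> \<open>One \<open>\<eta>\<close> for uniform continuity between \<open>x\<close>
        and its centre, one for perturbing the target value at the centre.\<close>
      then have "norm (G x - \<psi> (grid_center w x)) \<le> 2 * \<eta>"
        using y(3)[OF c] dist_triangle[of "G x" "y (grid_center w x)" "G (grid_center w x)"]
        by (simp add: \<psi>(2)[OF c] dist_norm)
      then show ?thesis
        using assms(2) by (auto simp: v_def intro!: mult_left_mono ennreal_leI powr_mono2)
    qed (simp add: v_def)
    then have "(\<integral>\<^sup>+x. v x \<partial>lborel) \<le> (\<integral>\<^sup>+x. indicator K x * ennreal ((2 * \<eta>) powr p) \<partial>lborel)"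
      by (intro nn_integral_mono)
    also have "\<dots> = ennreal ((2 * \<eta>) powr p * m)"
      using m by (subst nn_integral_multc) (auto simp: mult.commute ennreal_mult)
    also have "\<dots> < ennreal (\<epsilon> powr p)"
      using small assms(5) by (intro ennreal_lessI) auto
    finally show ?thesis .
  qed
  ultimately have "\<forall>\<^sub>F n in sequentially. (\<integral>\<^sup>+x. u n x \<partial>lborel) < ennreal (\<epsilon> powr p)"
    by (rule order_tendstoD(2))
  then obtain n where "(\<integral>\<^sup>+x. u n x \<partial>lborel) < ennreal (\<epsilon> powr p)"
    using eventually_happens'[OF sequentially_bot] by blast
  then have "Lp_close p K G (\<lambda>x. \<psi> (sine_map w (real n) x)) \<epsilon>"
    by (simp add: Lp_close_def u_def)
  then show ?thesis
    using w \<psi>(1) of_nat_0_le_iff by blast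
qed

text \<open>The part of the ball of radius 2 that \<open>\<phi>\<close> sends into the unit ball has
  at most the unit ball's volume. On the rest, of volume at least \<open>d\<close>, the norm of
  \<open>\<phi>\<close> is at least 1, so the integral is at least \<open>d\<close>;
  \<open>\<epsilon> = d powr (1 / p)\<close> turns the threshold into \<open>d\<close>.\<close>

lemma measure_preserving_not_Lp_close:
  assumes "1 \<le> p"
  shows "\<exists>\<epsilon>>0. \<forall>\<phi> \<in> borel_measurable borel. distr lborel borel \<phi> = lborel \<longrightarrow>
    \<not> Lp_close p (cball 0 2) (\<lambda>_::'a::euclidean_space. 0) \<phi> \<epsilon>"
proof -
  let ?K = "cball 0 2 :: 'a set" and ?b = "ball 0 1 :: 'a set"
  define d where "d = measure lborel ?K - measure lborel ?b"
  have "measure lborel ?b < 2 ^ DIM('a) * measure lborel ?b"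
    using content_ball_pos[of 1 "0 :: 'a"] power_gt1_lemma[of "2 :: real"]
    by (simp add: one_less_power)
  then have d: "0 < d"
    using content_ball_conv_unit_ball[of 2 "0 :: 'a"] by (simp add: d_def content_cball_conv_ball)
  have "\<not> Lp_close p ?K (\<lambda>_. 0) \<phi> (d powr (1 / p))"
    if [measurable]: "\<phi> \<in> borel_measurable borel" and \<phi>: "distr lborel borel \<phi> = lborel" for \<phi>
  proof
    assume "Lp_close p ?K (\<lambda>_. 0) \<phi> (d powr (1 / p))"
    then have less: "(\<integral>\<^sup>+x. indicator ?K x * ennreal (norm (\<phi> x) powr p) \<partial>lborel) < ennreal d"
      using assms d by (simp add: Lp_close_def powr_powr)
    have [measurable]: "\<phi> -` ?b \<in> sets borel"
      using measurable_sets[OF that(1), of ?b] by simp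
    have "emeasure lborel (?K - \<phi> -` ?b) = (\<integral>\<^sup>+x. indicator (?K - \<phi> -` ?b) x \<partial>lborel)"
      by simp
    also have "\<dots> \<le> (\<integral>\<^sup>+x. indicator ?K x * ennreal (norm (\<phi> x) powr p) \<partial>lborel)"
      using assms by (intro nn_integral_mono) (auto simp: indicator_def ge_one_powr_ge_zero)
    finally have "emeasure lborel (?K - \<phi> -` ?b) < ennreal d"
      using less by simp
    moreover have "emeasure lborel ?K \<le> emeasure lborel (?K - \<phi> -` ?b) + emeasure lborel (\<phi> -` ?b)"
      by (rule order_trans[OF emeasure_mono emeasure_subadditive]) auto
    moreover have "emeasure lborel (\<phi> -` ?b) = emeasure lborel ?b"
      using emeasure_distr[of \<phi> lborel borel ?b] \<phi> by simp
    moreover have "emeasure lborel ?K = ennreal (measure lborel ?K)" "emeasure lborel ?b = ennreal (measure lborel ?b)"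
      by (intro emeasure_eq_ennreal_measure less_imp_neq
          emeasure_lborel_ball_finite[unfolded infinity_ennreal_def]
          emeasure_lborel_cball_finite[unfolded infinity_ennreal_def])+
    ultimately have "ennreal (measure lborel ?K) \<le> emeasure lborel (?K - \<phi> -` ?b) + ennreal (measure lborel ?b)"
      and X: "emeasure lborel (?K - \<phi> -` ?b) < ennreal d"
      by simp_all
    moreover obtain x where "0 \<le> x" "emeasure lborel (?K - \<phi> -` ?b) = ennreal x"
      using X by (cases "emeasure lborel (?K - \<phi> -` ?b)") auto
    ultimately have "measure lborel ?K \<le> x + measure lborel ?b" "x < d"
      by (simp_all add: ennreal_less_iff flip: ennreal_plus)
    then show False
      by (simp add: d_def)
  qed
  then show ?thesis
    using d by (intro exI[of _ "d powr (1 / p)"]) auto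
qed

section \<open>Properties of the two systems\<close>

text \<open>Conjugate the interpolation of nonzero data by a translation along one axis that moves
  all sources and targets off the origin.\<close>

lemma universal_interpolation_monomial_shears:
  assumes "CARD('n::finite) \<ge> 2"
  shows "universal_interpolation (monomial_shears UNIV :: (real^'n \<Rightarrow> real^'n) set)"
  unfolding universal_interpolation_def
proof (intro allI impI, elim conjE)
  fix N and xs ys :: "nat \<Rightarrow> real^'n"
  assume inj: "inj_on xs {..<N}" "inj_on ys {..<N}"
  obtain i j :: 'n where ij: "i \<noteq> j"
    using assms card_le_Suc0_iff_eq[of "UNIV :: 'n set"] by force
  \<comment> \<open>Exponent 0 makes the shear a translation: \<open>s ^ 0 = 1\<close>, also at
    \<open>s = 0\<close>.\<close>
  define T :: "real \<Rightarrow> real^'n \<Rightarrow> real^'n" where "T c = shear i j (\<lambda>s. c * s ^ 0)" for c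
  have T: "shear_map UNIV (T c)" for c
    unfolding T_def using ij by (intro shear_map.shear) auto
  have T_inv: "T (-c) (T c x) = x" for c x
    using ij by (simp add: T_def vec_eq_iff shear_nth)
  \<comment> \<open>A shift avoiding finitely many values gives every shifted data point a nonzero
    coordinate \<open>i\<close>.\<close>
  obtain c where c: "c \<notin> (\<lambda>x. - (x $ i)) ` (xs ` {..<N} \<union> ys ` {..<N})"
    using ex_new_if_finite[OF infinite_UNIV_char_0] by (metis finite_Un finite_imageI finite_lessThan)
  have c0: "T c x \<noteq> 0" if "x \<in> xs ` {..<N} \<union> ys ` {..<N}" for x
  proof
    assume "T c x = 0"
    then have "T c x $ i = 0"
      by simp
    then have "c = - (x $ i)"
      by (simp add: T_def shear_nth)
    then show False
      using c that by blast
  qed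
  have "inj (T c)"
    using T_inv by (metis injI)
  then have "inj_on (\<lambda>k. T c (xs k)) {..<N}" "inj_on (\<lambda>k. T c (ys k)) {..<N}"
    using inj by (auto simp: inj_on_def)
  moreover have "0 \<notin> (\<lambda>k. T c (xs k)) ` {..<N}" "0 \<notin> (\<lambda>k. T c (ys k)) ` {..<N}"
    using c0 by (fastforce simp: image_iff)+
  ultimately obtain \<psi> where \<psi>: "shear_map {1..} \<psi>" "\<And>k. k < N \<Longrightarrow> \<psi> (T c (xs k)) = T c (ys k)"
    using shear_map_interpolation[OF assms, of "{..<N}"] by force
  have "shear_map UNIV (T (-c) \<circ> (\<psi> \<circ> T c))"
    using T shear_map_mono[OF \<psi>(1)] by (intro shear_map.comp) auto
  then have "attainable_on (monomial_shears UNIV) (xs ` {..<N}) (T (-c) \<circ> (\<psi> \<circ> T c))"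
    by (intro attainable_on_mono[OF shear_map_attainable]) auto
  moreover have "\<forall>k<N. (T (-c) \<circ> (\<psi> \<circ> T c)) (xs k) = ys k"
    using \<psi>(2) T_inv by simp
  ultimately show "\<exists>\<phi>. attainable_on (monomial_shears UNIV) (xs ` {..<N}) \<phi> \<and> (\<forall>k<N. \<phi> (xs k) = ys k)"
    by blast
qed

text \<open>Every attainable map is a composition of shears, hence continuous and measure
  preserving, so the zero function on the ball of radius 2 is out of reach.\<close>

lemma not_universal_approximation_monomial_shears:
  assumes "1 \<le> p"
  shows "\<not> universal_approximation_Lp p (monomial_shears K :: (real^'n \<Rightarrow> real^'n::finite) set)"
proof
  assume approx: "universal_approximation_Lp p (monomial_shears K :: (real^'n \<Rightarrow> real^'n) set)"
  obtain \<epsilon> where \<epsilon>: "0 < \<epsilon>" "\<And>\<phi>. \<phi> \<in> borel_measurable borel \<Longrightarrow> distr lborel borel \<phi> = lborel \<Longrightarrow>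
      \<not> Lp_close p (cball 0 2) (\<lambda>_::real^'n. 0) \<phi> \<epsilon>"
    using measure_preserving_not_Lp_close[OF assms] by metis
  have "continuous_on UNIV (\<lambda>_::real^'n. 0 :: real^'n)" "compact (cball (0 :: real^'n) 2)"
    by auto
  then obtain \<phi> :: "real^'n \<Rightarrow> real^'n" where \<phi>: "attainable_on (monomial_shears K) (cball 0 2) \<phi>"
    "Lp_close p (cball 0 2) (\<lambda>_. 0) \<phi> \<epsilon>"
    using approx \<epsilon>(1) unfolding universal_approximation_Lp_def by metis
  then have "shear_map K \<phi>"
    unfolding attainable_on_def using shear_map_comp_flows by blast
  then show False
    using \<phi>(2) \<epsilon>(2) distr_lborel_shear_map borel_measurable_continuous_onI continuous_on_shear_map by blast
qed

lemma universal_approximation_shears_sine: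
  assumes "CARD('n::finite) \<ge> 2" "1 \<le> p"
  shows "universal_approximation_Lp p (monomial_shears {1..} \<union> range sine_field :: (real^'n \<Rightarrow> real^'n) set)"
  unfolding universal_approximation_Lp_def
proof (intro allI impI, elim conjE)
  fix G :: "real^'n \<Rightarrow> real^'n" and K :: "(real^'n) set" and \<epsilon> :: real
  assume "continuous_on UNIV G" "compact K" "0 < \<epsilon>"
  then obtain w t \<psi> where "w > 0" "t \<ge> 0" "shear_map {1..} \<psi>"
    "Lp_close p K G (\<lambda>x. \<psi> (sine_map w t x)) \<epsilon>"
    using Lp_close_shear_map_sine_map[OF assms] by metis
  then show "\<exists>\<phi>. attainable_on (monomial_shears {1..} \<union> range sine_field) K \<phi> \<and> Lp_close p K G \<phi> \<epsilon>"
    using shear_map_sine_map_attainable[of "monomial_shears {1..} \<union> range sine_field" w t \<psi> K] by auto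
qed

text \<open>A single data pair refutes it: no attainable map moves the common zero \<open>z\<close>
  to another point \<open>y\<close>.\<close>

lemma not_universal_interpolation_fixed_point:
  fixes F :: "('a::euclidean_space \<Rightarrow> 'a) set"
  assumes "\<And>g. g \<in> F \<Longrightarrow> local_lipschitz (UNIV::real set) UNIV (\<lambda>_. g)"
    and "\<And>g. g \<in> F \<Longrightarrow> g z = 0"
  shows "\<not> universal_interpolation F"
proof
  obtain y where y: "y \<noteq> z"
    using perfect_choose_dist[of 1 z] by auto
  assume "universal_interpolation F"
  then obtain \<phi> where "attainable_on F ((\<lambda>_::nat. z) ` {..<1}) \<phi>" "\<phi> z = y"
    unfolding universal_interpolation_def
    by (elim allE[of _ 1] allE[of _ "\<lambda>_. z"] allE[of _ "\<lambda>_. y"]) (auto simp: inj_on_def)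
  then show False
    using y comp_flows_fixed_point[of F z] assms unfolding attainable_on_def by blast
qed

theorem theorem2p9:
  assumes "CARD('n::finite) \<ge> 2"
  shows "(\<exists>l \<Theta> (f :: real^'n \<Rightarrow> real list \<Rightarrow> real^'n).
            control_system l \<Theta> f \<and> universal_interpolation (control_family \<Theta> f) \<and>
            (\<forall>p. 1 \<le> p \<longrightarrow> \<not> universal_approximation_Lp p (control_family \<Theta> f)))
       \<and> (\<exists>l \<Theta> (f :: real^'n \<Rightarrow> real list \<Rightarrow> real^'n).
            control_system l \<Theta> f \<and> \<not> universal_interpolation (control_family \<Theta> f) \<and>
            (\<forall>p. 1 \<le> p \<longrightarrow> universal_approximation_Lp p (control_family \<Theta> f)))"
proof
  define m :: "'n \<times> 'n \<times> nat \<Rightarrow> real \<Rightarrow> real^'n \<Rightarrow> real^'n"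
    where "m = (\<lambda>(i, j, k) a. shear_field i j (\<lambda>s. a * s ^ k))"
  define C :: "nat set \<Rightarrow> ('n \<times> 'n \<times> nat) set" where "C K = {(i, j, k). i \<noteq> j \<and> k \<in> K}" for K
  have m: "monomial_shears K = {m c a | c a. c \<in> C K}" for K
    by (force simp: monomial_shears_def m_def C_def)
  have ll_m: "local_lipschitz (UNIV::real set) UNIV (\<lambda>_. m c a)" for c a
    by (cases c) (simp add: m_def local_lipschitz_monomial_shear)
  obtain l \<Theta> and f :: "real^'n \<Rightarrow> real list \<Rightarrow> real^'n" where
    "control_system l \<Theta> f" "control_family \<Theta> f = monomial_shears UNIV"
    unfolding m by (rule control_system_countable_real[of "C UNIV" m, OF ll_m])
  then show "\<exists>l \<Theta> (f :: real^'n \<Rightarrow> real list \<Rightarrow> real^'n).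
      control_system l \<Theta> f \<and> universal_interpolation (control_family \<Theta> f) \<and>
      (\<forall>p. 1 \<le> p \<longrightarrow> \<not> universal_approximation_Lp p (control_family \<Theta> f))"
    using universal_interpolation_monomial_shears[OF assms] not_universal_approximation_monomial_shears
    by metis
  let ?F = "monomial_shears {1..} \<union> range sine_field :: (real^'n \<Rightarrow> real^'n) set"
  \<comment> \<open>\<open>None\<close> selects the sine fields, the real parameter then being the
    width \<open>w\<close>; \<open>Some\<close> selects the shears.\<close>
  define g where "g = case_option sine_field m"
  have ll_g: "local_lipschitz (UNIV::real set) UNIV (\<lambda>_. g c a)" for c a
    by (cases c) (simp_all add: g_def ll_m local_lipschitz_sine_field)
  have g: "?F = {g c a | c a. c \<in> insert None (Some ` C {1..})}"
  proof -
    have "{g c a | c a. c \<in> insert None (Some ` D)} = {g (Some c) a | c a. c \<in> D} \<union> range (g None)" for D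
      by blast
    then show ?thesis
      by (simp add: m g_def)
  qed
  obtain l \<Theta> and f :: "real^'n \<Rightarrow> real list \<Rightarrow> real^'n" where
    "control_system l \<Theta> f" "control_family \<Theta> f = ?F"
    unfolding g by (rule control_system_countable_real[of "insert None (Some ` C {1..})" g, OF ll_g])
  moreover have "\<not> universal_interpolation ?F"
  proof (rule not_universal_interpolation_fixed_point)
    show "local_lipschitz (UNIV::real set) UNIV (\<lambda>_. h)" if "h \<in> ?F" for h
      using that ll_g unfolding g by blast
    \<comment> \<open>The origin is the common zero: \<open>sin 0 = 0\<close>, and
      \<open>0 ^ k = 0\<close> because \<open>k \<ge> 1\<close>.\<close>
    show "h 0 = 0" if "h \<in> ?F" for h
      using that by (auto simp: monomial_shears_def shear_field_def sine_field_def vec_eq_iff)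
  qed
  ultimately show "\<exists>l \<Theta> (f :: real^'n \<Rightarrow> real list \<Rightarrow> real^'n).
      control_system l \<Theta> f \<and> \<not> universal_interpolation (control_family \<Theta> f) \<and>
      (\<forall>p. 1 \<le> p \<longrightarrow> universal_approximation_Lp p (control_family \<Theta> f))"
    using universal_approximation_shears_sine[OF assms] by metis
qed

end
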